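(* Let $\mathbf{k}$ be a finite field with $q$ elements and let $p$ be a prime. If $q\not\equiv 0,1 \pmod p$, then there are no graph homomorphisms $A_{\mathbf{k}^p}\to K_p$, and so $\chi(A_{\mathbf{k}^p})>p=s_{\mathbf{k}}\chi(A_{\mathbf{k}^p})$.
   Context: $K_p$ is the complete graph on $p$ vertices and $\chi$ the usual chromatic number. For $n\geq 0$, let $P\mathbf{k}^n$ be the set of $1$-dimensional subspaces of $\mathbf{k}^n$ and $\mathrm{Gr}_{n-1}(\mathbf{k}^n)$ the set of $(n-1)$-dimensional subspaces. The (simple undirected) graph $A_{\mathbf{k}^n}$ has vertex set $\{(U,V)\in P\mathbf{k}^n\times\mathrm{Gr}_{n-1}(\mathbf{k}^n)\mid U\not\subset V\}$, with $(U,V)$ and $(U',V')$ joined by an edge if and only if $U\subset V'$ and $U'\subset V$. An $n$-span colouring of a graph $G$ over $\mathbf{k}$ is a function assigning to each vertex $x$ a pair $(U_x,V_x)\in P\mathbf{k}^n\times\mathrm{Gr}_{n-1}(\mathbf{k}^n)$ such that $U_x\not\subset V_x$ for every vertex $x$, and $U_x\subset V_y$, $U_y\subset V_x$ for every edge $(x,y)$. The span chromatic number $s_{\mathbf{k}}\chi(G)$ is the least $n$ for which an $n$-span colouring of $G$ over $\mathbf{k}$ exists. *)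

theory Defs
  imports
    "Jordan_Normal_Form.VS_Connect"
    "Graph_Theory.Kuratowski"
    "HOL-Number_Theory.Cong"
    "HOL-Library.Extended_Nat"
    "HOL-Library.Cardinality"
begin

section \<open>Graphs, homomorphisms, chromatic number\<close>

text \<open>A simple undirected graph is an \<open>'a pair_pre_digraph\<close> satisfying \<open>pair_bidirected_digraph\<close>:
  an edge is represented by both of its orientations, and there are no loops.\<close>

definition graph_hom :: "'a pair_pre_digraph \<Rightarrow> 'b pair_pre_digraph \<Rightarrow> ('a \<Rightarrow> 'b) \<Rightarrow> bool" where
  "graph_hom G H f \<longleftrightarrow>
     f \<in> pverts G \<rightarrow> pverts H \<and> (\<forall>(x, y) \<in> parcs G. (f x, f y) \<in> parcs H)"

definition complete_graph :: "nat \<Rightarrow> nat pair_pre_digraph" where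
  "complete_graph n =
     \<lparr> pverts = {..<n}, parcs = {(i, j). i < n \<and> j < n \<and> i \<noteq> j} \<rparr>"

definition proper_colouring :: "'a pair_pre_digraph \<Rightarrow> nat \<Rightarrow> ('a \<Rightarrow> nat) \<Rightarrow> bool" where
  "proper_colouring G n c \<longleftrightarrow>
     c \<in> pverts G \<rightarrow> {..<n} \<and> (\<forall>(x, y) \<in> parcs G. c x \<noteq> c y)"

text \<open>The value is \<open>\<infinity>\<close> (the infimum of the empty set) if no finite colouring exists;
  likewise for the span chromatic number below.\<close>

definition chromatic_number :: "'a pair_pre_digraph \<Rightarrow> enat" where
  "chromatic_number G = (INF n \<in> {n. \<exists>c. proper_colouring G n c}. enat n)"

lemma complete_graph: "complete_digraph n (with_proj (complete_graph n))"
  unfolding complete_digraph_pair_def complete_graph_def by auto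

section \<open>Lines and hyperplanes of the coordinate space\<close>

definition subspaces_of_dim :: "nat \<Rightarrow> nat \<Rightarrow> 'k::field vec set set" where
  "subspaces_of_dim n d =
     {W. VectorSpace.subspace class_ring W (module_vec TYPE('k) n) \<and>
         vectorspace.dim class_ring ((module_vec TYPE('k) n)\<lparr>carrier := W\<rparr>) = d}"

definition lines :: "nat \<Rightarrow> 'k::field vec set set" where
  "lines n = subspaces_of_dim n 1"

text \<open>There are no subspaces of dimension \<open>n - 1\<close> for \<open>n = 0\<close>, so the truncated
  subtraction on the natural numbers is avoided.\<close>

definition hyperplanes :: "nat \<Rightarrow> 'k::field vec set set" where
  "hyperplanes n = (case n of 0 \<Rightarrow> {} | Suc d \<Rightarrow> subspaces_of_dim n d)"

section \<open>The graph of line-hyperplane pairs and span colourings\<close>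

definition span_graph :: "nat \<Rightarrow> ('k::field vec set \<times> 'k vec set) pair_pre_digraph" where
  "span_graph n =
     (let X = {(U, V). U \<in> lines n \<and> V \<in> hyperplanes n \<and> \<not> U \<subseteq> V}
      in \<lparr> pverts = X,
           parcs = {((U, V), (U', V')). (U, V) \<in> X \<and> (U', V') \<in> X \<and> U \<subseteq> V' \<and> U' \<subseteq> V} \<rparr>)"

lemma span_graph_simple: "pair_bidirected_digraph (span_graph n)"
  by unfold_locales (auto simp: span_graph_def symmetric_def sym_def Let_def)

definition span_colouring ::
  "'a pair_pre_digraph \<Rightarrow> nat \<Rightarrow> ('a \<Rightarrow> 'k::field vec set \<times> 'k vec set) \<Rightarrow> bool" where
  "span_colouring G n f \<longleftrightarrow>
     (\<forall>x \<in> pverts G. fst (f x) \<in> lines n \<and> snd (f x) \<in> hyperplanes n \<and>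
        \<not> fst (f x) \<subseteq> snd (f x)) \<and>
     (\<forall>(x, y) \<in> parcs G. fst (f x) \<subseteq> snd (f y) \<and> fst (f y) \<subseteq> snd (f x))"

definition span_chromatic_number :: "'k::field itself \<Rightarrow> 'a pair_pre_digraph \<Rightarrow> enat" where
  "span_chromatic_number _ G =
     (INF n \<in> {n. \<exists>f :: 'a \<Rightarrow> 'k vec set \<times> 'k vec set. span_colouring G n f}. enat n)"

end

theory Submission
  imports Defs "HOL-Number_Theory.Residues"
begin

text \<open>A vertex of \<open>A\<close> is given by a vector \<open>u\<close> and a functional \<open>\<phi>\<close> with \<open>\<phi> \<bullet> u = 1\<close>,
  up to scaling. An invertible matrix \<open>g\<close> with inverse \<open>h\<close> yields a clique of size \<open>p\<close>: the
  columns of \<open>g\<close> paired with the rows of \<open>h\<close>. By transitivity of the general linear group the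
  number of such \<open>(g, h)\<close> whose \<open>i\<close>-th pair is a prescribed one does not depend on that pair,
  and hence, the total being fixed, not on \<open>i\<close> either. In a colouring with \<open>p\<close> colours every
  clique uses each colour exactly once, so a colour class contains exactly the fraction
  \<open>1 / p\<close> of all pairs \<open>(u, \<phi>)\<close>. But \<open>q\<close> times the number of these pairs is
  \<open>(q ^ p - 1) * q ^ p\<close>, which is \<open>(q - 1) * q\<close> modulo \<open>p\<close> by Fermat and not divisible by \<open>p\<close>.

  The clique of the standard basis also bounds the span chromatic number: vectors chosen in
  the lines outside the respective hyperplanes are linearly independent.\<close>

section \<open>Lines and hyperplanes from vectors and functionals\<close>

definition line_of :: "'k::field vec \<Rightarrow> 'k vec set" where
  "line_of u = range (\<lambda>c. c \<cdot>\<^sub>v u)"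

definition perp :: "nat \<Rightarrow> 'k::field vec \<Rightarrow> 'k vec set" where
  "perp n \<phi> = {v \<in> carrier_vec n. \<phi> \<bullet> v = 0}"

lemma linear_map_vecI:
  fixes T :: "'k::field vec \<Rightarrow> 'k vec"
  assumes "\<And>v. v \<in> carrier_vec m \<Longrightarrow> T v \<in> carrier_vec n"
    and "\<And>v w. v \<in> carrier_vec m \<Longrightarrow> w \<in> carrier_vec m \<Longrightarrow> T (v + w) = T v + T w"
    and "\<And>c v. v \<in> carrier_vec m \<Longrightarrow> T (c \<cdot>\<^sub>v v) = c \<cdot>\<^sub>v T v"
  shows "linear_map class_ring (module_vec TYPE('k) m) (module_vec TYPE('k) n) T"
  using assms
  by (auto simp: linear_map_def mod_hom_def mod_hom_axioms_def LinearCombinations.module_hom_def vec_vs vec_module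
      module_vec_simps)

text \<open>The map \<open>c \<mapsto> c u\<close> from the one-dimensional space is injective,
  since \<open>u\<close> has a nonzero coordinate, and has image \<open>line_of u\<close>;
  rank-nullity gives the dimension.\<close>

lemma line_of_in_lines:
  fixes u :: "'k::field vec"
  assumes u: "u \<in> carrier_vec n" and u0: "u \<noteq> 0\<^sub>v n"
  shows "line_of u \<in> lines n"
proof -
  let ?T = "\<lambda>c :: 'k vec. c $ 0 \<cdot>\<^sub>v u"
  interpret T: linear_map class_ring "module_vec TYPE('k) 1" "module_vec TYPE('k) n" ?T
    using u by (intro linear_map_vecI) (auto simp: add_smult_distrib_vec smult_smult_assoc)
  have im: "T.im = line_of u"
  proof -
    have "c \<cdot>\<^sub>v u \<in> ?T ` carrier_vec 1" for c
      by (rule image_eqI[of _ _ "vec 1 (\<lambda>_. c)"]) auto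
    then show ?thesis
      unfolding T.im_def by (auto simp: line_of_def module_vec_simps)
  qed
  have inj: "inj_on ?T (carrier (module_vec TYPE('k) 1))"
  proof (rule inj_onI)
    fix c d :: "'k vec"
    assume cd: "c \<in> carrier (module_vec TYPE('k) 1)" "d \<in> carrier (module_vec TYPE('k) 1)"
      and eq: "c $ 0 \<cdot>\<^sub>v u = d $ 0 \<cdot>\<^sub>v u"
    obtain i where i: "i < n" "u $ i \<noteq> 0"
      using u u0 by (metis carrier_vecD eq_vecI index_zero_vec)
    have "c $ 0 * u $ i = d $ 0 * u $ i"
      using arg_cong[OF eq, of "\<lambda>v. v $ i"] i u by auto
    with i cd show "c = d" by (intro eq_vecI) (auto simp: module_vec_simps)
  qed
  have "vectorspace.dim class_ring ((module_vec TYPE('k) n)\<lparr>carrier := line_of u\<rparr>) = 1"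
    unfolding im[symmetric] using T.rank_nullity[OF vec_space.fin_dim] T.inj_imp_dim_ker0[OF inj]
    by (simp add: vec_space.dim_is_n)
  with T.imT_is_subspace[unfolded im] show ?thesis
    by (simp add: lines_def subspaces_of_dim_def)
qed

text \<open>Rank-nullity for the functional given by \<open>\<phi>\<close>: its kernel is
  \<open>perp n \<phi>\<close>, and it is onto because
  \<open>\<phi> \<bullet> u = 1\<close>.\<close>

lemma perp_in_hyperplanes:
  fixes \<phi> :: "'k::field vec"
  assumes \<phi>: "\<phi> \<in> carrier_vec n" and u: "u \<in> carrier_vec n" and \<phi>u: "\<phi> \<bullet> u = 1"
  shows "perp n \<phi> \<in> hyperplanes n"
proof -
  let ?T = "\<lambda>v. vec 1 (\<lambda>_. \<phi> \<bullet> v)"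
  interpret T: linear_map class_ring "module_vec TYPE('k) n" "module_vec TYPE('k) 1" ?T
    using \<phi> by (intro linear_map_vecI) (auto simp: scalar_prod_add_distrib)
  have ker: "T.ker = perp n \<phi>"
    unfolding T.ker_def by (auto simp: perp_def module_vec_simps vec_eq_iff)
  have "w \<in> ?T ` carrier_vec n" if "w \<in> carrier_vec 1" for w
    using that u \<phi> \<phi>u by (intro image_eqI[of _ _ "w $ 0 \<cdot>\<^sub>v u"]) auto
  then have im: "T.im = carrier (module_vec TYPE('k) 1)"
    unfolding T.im_def by (auto simp: module_vec_simps)
  have eq: "(module_vec TYPE('k) 1)\<lparr>carrier := carrier (module_vec TYPE('k) 1)\<rparr> = module_vec TYPE('k) 1"
    by simp
  \<comment> \<open>The additive form also refutes \<open>n = 0\<close> in the case split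
    below.\<close>
  have d: "vectorspace.dim class_ring ((module_vec TYPE('k) n)\<lparr>carrier := perp n \<phi>\<rparr>) + 1 = n"
    using T.rank_nullity[OF vec_space.fin_dim]
    by (simp only: ker im eq vec_space.dim_is_n)
  show ?thesis
    using d T.kerT_is_subspace[unfolded ker]
    by (cases n) (auto simp: hyperplanes_def subspaces_of_dim_def)
qed

section \<open>Frames and dual pairs\<close>

definition dual_pairs :: "nat \<Rightarrow> ('k::field vec \<times> 'k vec) set" where
  "dual_pairs n = {(u, \<phi>). u \<in> carrier_vec n \<and> \<phi> \<in> carrier_vec n \<and> \<phi> \<bullet> u = 1}"

text \<open>An element of the general linear group together with its inverse: a basis in the columns
  of \<open>g\<close>, its dual basis in the rows of \<open>h\<close>.\<close>

definition frames :: "nat \<Rightarrow> ('k::field mat \<times> 'k mat) set" where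
  "frames n = {(g, h). g \<in> carrier_mat n n \<and> h \<in> carrier_mat n n \<and> g * h = 1\<^sub>m n \<and> h * g = 1\<^sub>m n}"

definition fibre :: "nat \<Rightarrow> nat \<Rightarrow> 'k::field vec \<times> 'k vec \<Rightarrow> ('k mat \<times> 'k mat) set" where
  "fibre n i x = {(g, h) \<in> frames n. (col g i, row h i) = x}"

section \<open>Cardinality and finiteness over a finite field\<close>

lemma card_carrier_vec: "card (carrier_vec n :: 'k::finite vec set) = CARD('k) ^ n"
proof -
  let ?f = "vec n :: (nat \<Rightarrow> 'k) \<Rightarrow> 'k vec"
  have "inj_on ?f ({..<n} \<rightarrow>\<^sub>E UNIV)"
  proof (rule inj_onI)
    fix a b :: "nat \<Rightarrow> 'k"
    assume ab: "a \<in> {..<n} \<rightarrow>\<^sub>E UNIV" "b \<in> {..<n} \<rightarrow>\<^sub>E UNIV" and eq: "vec n a = vec n b"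
    show "a = b"
    proof (rule PiE_ext[OF ab])
      fix i assume "i \<in> {..<n}"
      then show "a i = b i" using arg_cong[OF eq, of "\<lambda>v. v $ i"] by simp
    qed
  qed
  moreover have "carrier_vec n = ?f ` ({..<n} \<rightarrow>\<^sub>E UNIV)"
  proof (intro equalityI image_subsetI vec_carrier subsetI)
    fix v :: "'k vec" assume "v \<in> carrier_vec n"
    then have "v = vec n (restrict (\<lambda>i. v $ i) {..<n})"
      by (intro eq_vecI) auto
    then show "v \<in> ?f ` ({..<n} \<rightarrow>\<^sub>E UNIV)"
      by - (rule image_eqI, assumption, simp)
  qed
  ultimately have "card (carrier_vec n :: 'k vec set) = card ({..<n} \<rightarrow>\<^sub>E (UNIV :: 'k set))"
    by (simp add: card_image)
  then show ?thesis
    by (simp add: card_PiE)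
qed

lemma finite_carrier_vec [simp]: "finite (carrier_vec n :: 'k::finite vec set)"
  by (rule card_ge_0_finite) (simp add: card_carrier_vec)

lemma finite_carrier_mat: "finite (carrier_mat n m :: 'k::finite mat set)"
proof (rule finite_subset)
  show "carrier_mat n m \<subseteq> (\<lambda>f. mat n m f) ` (({..<n} \<times> {..<m}) \<rightarrow>\<^sub>E (UNIV :: 'k set))"
  proof
    fix A :: "'k mat"
    assume "A \<in> carrier_mat n m"
    then have "A = mat n m (restrict (\<lambda>x. A $$ x) ({..<n} \<times> {..<m}))"
      by (intro eq_matI) auto
    then show "A \<in> (\<lambda>f. mat n m f) ` (({..<n} \<times> {..<m}) \<rightarrow>\<^sub>E (UNIV :: 'k set))"
      by - (rule image_eqI, assumption, simp)
  qed
qed (simp add: finite_PiE)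

lemma finite_frames: "finite (frames n :: ('k::{field,finite} mat \<times> 'k mat) set)"
  by (rule finite_subset[of _ "carrier_mat n n \<times> carrier_mat n n"])
    (auto simp: frames_def finite_carrier_mat)

lemma finite_dual_pairs: "finite (dual_pairs n :: ('k::{field,finite} vec \<times> 'k vec) set)"
  by (rule finite_subset[of _ "carrier_vec n \<times> carrier_vec n"]) (auto simp: dual_pairs_def)

section \<open>Frames as dual bases and the action of the general linear group\<close>

lemma frames_scalar_prod:
  assumes "(g, h) \<in> frames n" "i < n" "j < n"
  shows "row h i \<bullet> col g j = (if i = j then 1 else 0)"
proof -
  have "row h i \<bullet> col g j = (h * g) $$ (i, j)"
    using assms by (intro index_mult_mat(1)[symmetric]) (auto simp: frames_def)
  also have "\<dots> = 1\<^sub>m n $$ (i, j)"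
    using assms by (simp add: frames_def del: index_mult_mat)
  finally show ?thesis
    using assms by simp
qed

lemma frame_in_dual_pairs:
  assumes "(g, h) \<in> frames n" "i < n"
  shows "(col g i, row h i) \<in> dual_pairs n"
  using frames_scalar_prod[OF assms(1) assms(2) assms(2)] assms
  by (auto simp: dual_pairs_def frames_def)

text \<open>The translation \<open>(g, h) \<mapsto> (A g, h B)\<close> is undone by
  \<open>(B, A)\<close>, hence injective; it applies \<open>A\<close> to the columns of
  \<open>g\<close> and the transpose of \<open>B\<close> to the rows of \<open>h\<close>. One
  inequality suffices, since the two pairs can be exchanged later.\<close>

lemma card_fibre_translate:
  fixes A B :: "'k::{field,finite} mat"
  assumes AB: "(A, B) \<in> frames n" and i: "i < n"
    and act: "A *\<^sub>v u = u'" "B\<^sup>T *\<^sub>v \<phi> = \<phi>'"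
  shows "card (fibre n i (u, \<phi>)) \<le> card (fibre n i (u', \<phi>'))"
proof (rule card_inj_on_le)
  have carr: "A \<in> carrier_mat n n" "B \<in> carrier_mat n n"
    and inv: "A * B = 1\<^sub>m n" "B * A = 1\<^sub>m n"
    using AB by (auto simp: frames_def)
  let ?f = "\<lambda>(g, h). (A * g, h * B)"
  show "finite (fibre n i (u', \<phi>'))"
    by (rule finite_subset[OF _ finite_frames[of n]]) (auto simp: fibre_def)
  show "inj_on ?f (fibre n i (u, \<phi>))"
  proof (rule inj_on_inverseI[of _ "\<lambda>(g, h). (B * g, h * A)"])
    fix x assume "x \<in> fibre n i (u, \<phi>)"
    then obtain g h where x: "x = (g, h)" "g \<in> carrier_mat n n" "h \<in> carrier_mat n n"
      by (auto simp: fibre_def frames_def)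
    have "B * (A * g) = g" "h * B * A = h"
      using carr inv x by (simp_all flip: assoc_mult_mat[of B n n A n g n]
          add: assoc_mult_mat[of h n n B n A n])
    then show "(case ?f x of (g, h) \<Rightarrow> (B * g, h * A)) = x"
      by (simp add: x)
  qed
  show "?f ` fibre n i (u, \<phi>) \<subseteq> fibre n i (u', \<phi>')"
  proof clarify
    fix g h assume gh: "(g, h) \<in> fibre n i (u, \<phi>)"
    then have g: "g \<in> carrier_mat n n" and h: "h \<in> carrier_mat n n"
      and inv': "g * h = 1\<^sub>m n" "h * g = 1\<^sub>m n" and cr: "col g i = u" "row h i = \<phi>"
      by (auto simp: fibre_def frames_def)
    have "A * g * (h * B) = A * (g * h) * B" "h * B * (A * g) = h * (B * A) * g"
      using g h carr by (simp_all add: assoc_mult_mat[of _ n n _ n _ n])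
    then have 1: "A * g * (h * B) = 1\<^sub>m n" "h * B * (A * g) = 1\<^sub>m n"
      using g h carr inv inv' by simp_all
    have 2: "col (A * g) i = u'"
      using carr g i cr act by (auto simp: col_mult2)
    \<comment> \<open>Transposing turns the row into a column, on which \<open>col_mult2\<close>
      acts.\<close>
    have "row (h * B) i = col ((h * B)\<^sup>T) i"
      using carr h i by simp
    also have "\<dots> = col (B\<^sup>T * h\<^sup>T) i"
      using carr h by (simp add: transpose_mult)
    also have "\<dots> = B\<^sup>T *\<^sub>v col (h\<^sup>T) i"
      using carr h i by (intro col_mult2) auto
    also have "\<dots> = \<phi>'"
      using h i cr act by simp
    finally show "(A * g, h * B) \<in> fibre n i (u', \<phi>')"
      using 1 2 g h carr by (auto simp: fibre_def frames_def)
  qed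
qed

section \<open>Shears\<close>

text \<open>The rank-one update \<open>I + w \<psi>^T\<close>, a transvection when
  \<open>\<psi> \<bullet> w = 0\<close>.\<close>

definition shear :: "nat \<Rightarrow> 'k::field vec \<Rightarrow> 'k vec \<Rightarrow> 'k mat" where
  "shear n w \<psi> = 1\<^sub>m n + mat n n (\<lambda>(i, j). w $ i * \<psi> $ j)"

lemma shear_carrier [simp]: "shear n w \<psi> \<in> carrier_mat n n"
  by (simp add: shear_def)

lemma shear_mult_vec:
  assumes "w \<in> carrier_vec n" "\<psi> \<in> carrier_vec n" "x \<in> carrier_vec n"
  shows "shear n w \<psi> *\<^sub>v x = x + (\<psi> \<bullet> x) \<cdot>\<^sub>v w"
proof -
  have "mat n n (\<lambda>(i, j). w $ i * \<psi> $ j) *\<^sub>v x = (\<psi> \<bullet> x) \<cdot>\<^sub>v w"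
    using assms
    by (intro eq_vecI) (auto simp: scalar_prod_def sum_distrib_left sum_distrib_right mult_ac)
  with assms show ?thesis
    by (simp add: shear_def add_mult_distrib_mat_vec[of _ n n])
qed

lemma transpose_shear: "(shear n w \<psi>)\<^sup>T = shear n \<psi> w"
  by (rule eq_matI) (auto simp: shear_def)

text \<open>In the expanded product the linear terms cancel and the quadratic one carries the factor
  \<open>\<psi> \<bullet> w = 0\<close>. The check goes column by column.\<close>

lemma shear_mult_shear:
  assumes w: "w \<in> carrier_vec n" and \<psi>: "\<psi> \<in> carrier_vec n" and orth: "\<psi> \<bullet> w = 0"
  shows "shear n w \<psi> * shear n (- w) \<psi> = 1\<^sub>m n"
proof (rule eq_matI)
  fix i j assume "i < dim_row (1\<^sub>m n)" "j < dim_col (1\<^sub>m n)"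
  then have i: "i < n" and j: "j < n" by auto
  have colj: "col (shear n (- w) \<psi>) j = unit_vec n j - (\<psi> $ j) \<cdot>\<^sub>v w"
    using w \<psi> j by (intro eq_vecI) (auto simp: shear_def unit_vec_def)
  have "(shear n w \<psi> * shear n (- w) \<psi>) $$ (i, j) = (shear n w \<psi> *\<^sub>v col (shear n (- w) \<psi>) j) $ i"
    using i j by (auto simp: carrier_matD[OF shear_carrier])
  also have "\<dots> = unit_vec n j $ i"
    using w \<psi> i j orth unfolding colj
    by (simp add: shear_mult_vec scalar_prod_minus_distrib[of _ n] )
  finally show "(shear n w \<psi> * shear n (- w) \<psi>) $$ (i, j) = 1\<^sub>m n $$ (i, j)"
    using i j by (auto simp: unit_vec_def)
qed (auto simp: carrier_matD[OF shear_carrier])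

lemma shear_in_frames:
  assumes "w \<in> carrier_vec n" "\<psi> \<in> carrier_vec n" "\<psi> \<bullet> w = 0"
  shows "(shear n w \<psi>, shear n (- w) \<psi>) \<in> frames n"
  using shear_mult_shear[OF assms] shear_mult_shear[of "- w" n \<psi>] assms
  by (simp add: frames_def)

lemma card_fibre_shear:
  fixes u \<phi> :: "'k::{field,finite} vec"
  assumes "(u, \<phi>) \<in> dual_pairs n" "w \<in> carrier_vec n" "\<psi> \<in> carrier_vec n" "\<psi> \<bullet> w = 0" "i < n"
  shows "card (fibre n i (u, \<phi>))
    \<le> card (fibre n i (u + (\<psi> \<bullet> u) \<cdot>\<^sub>v w, \<phi> - (\<phi> \<bullet> w) \<cdot>\<^sub>v \<psi>))"
proof (rule card_fibre_translate[OF shear_in_frames[OF assms(2-4)] assms(5)])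
  have "w \<bullet> \<phi> = \<phi> \<bullet> w" using assms by (auto simp: dual_pairs_def intro: comm_scalar_prod)
  then show "(shear n (- w) \<psi>)\<^sup>T *\<^sub>v \<phi> = \<phi> - (\<phi> \<bullet> w) \<cdot>\<^sub>v \<psi>"
    using assms by (auto simp: transpose_shear shear_mult_vec dual_pairs_def)
qed (use assms in \<open>auto simp: shear_mult_vec dual_pairs_def\<close>)

section \<open>Transitivity on dual pairs\<close>

text \<open>The shear with \<open>w = u' - u\<close> and \<open>\<psi> = \<phi>\<close> does it:
  \<open>\<phi> \<bullet> u = 1\<close> sends \<open>u\<close> to \<open>u'\<close>, and
  \<open>\<phi> \<bullet> w = 0\<close> fixes \<open>\<phi>\<close>.\<close>

lemma card_fibre_change_vector:
  fixes u u' \<phi> :: "'k::{field,finite} vec"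
  assumes "(u, \<phi>) \<in> dual_pairs n" "(u', \<phi>) \<in> dual_pairs n" "i < n"
  shows "card (fibre n i (u, \<phi>)) = card (fibre n i (u', \<phi>))"
proof -
  have "card (fibre n i (u, \<phi>)) \<le> card (fibre n i (u', \<phi>))"
    if "(u, \<phi>) \<in> dual_pairs n" "(u', \<phi>) \<in> dual_pairs n" for u u' :: "'k vec"
  proof -
    have c: "u \<in> carrier_vec n" "u' \<in> carrier_vec n" "\<phi> \<in> carrier_vec n"
      "\<phi> \<bullet> u = 1" "\<phi> \<bullet> u' = 1"
      using that by (auto simp: dual_pairs_def)
    then have orth: "\<phi> \<bullet> (u' - u) = 0" by (simp add: scalar_prod_minus_distrib[of _ n])
    have "u + (\<phi> \<bullet> u) \<cdot>\<^sub>v (u' - u) = u'" "\<phi> - (\<phi> \<bullet> (u' - u)) \<cdot>\<^sub>v \<phi> = \<phi>"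
      using c by (auto simp: orth)
    with card_fibre_shear[OF that(1) _ c(3) orth assms(3)] c show ?thesis by simp
  qed
  with assms show ?thesis by (meson order_antisym)
qed

text \<open>Dually, the shear with \<open>w = u\<close> and \<open>\<psi> = \<phi> - \<phi>'\<close>
  fixes \<open>u\<close> and sends \<open>\<phi>\<close> to \<open>\<phi>'\<close>.\<close>

lemma card_fibre_change_functional:
  fixes u \<phi> \<phi>' :: "'k::{field,finite} vec"
  assumes "(u, \<phi>) \<in> dual_pairs n" "(u, \<phi>') \<in> dual_pairs n" "i < n"
  shows "card (fibre n i (u, \<phi>)) = card (fibre n i (u, \<phi>'))"
proof -
  have "card (fibre n i (u, \<phi>)) \<le> card (fibre n i (u, \<phi>'))"
    if "(u, \<phi>) \<in> dual_pairs n" "(u, \<phi>') \<in> dual_pairs n" for \<phi> \<phi>' :: "'k vec"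
  proof -
    have c: "u \<in> carrier_vec n" "\<phi> \<in> carrier_vec n" "\<phi>' \<in> carrier_vec n"
      "\<phi> \<bullet> u = 1" "\<phi>' \<bullet> u = 1"
      using that by (auto simp: dual_pairs_def)
    then have orth: "(\<phi> - \<phi>') \<bullet> u = 0" by (simp add: minus_scalar_prod_distrib[of _ n])
    have "u + ((\<phi> - \<phi>') \<bullet> u) \<cdot>\<^sub>v u = u" "\<phi> - (\<phi> \<bullet> u) \<cdot>\<^sub>v (\<phi> - \<phi>') = \<phi>'"
      using c by (auto simp: orth)
    with card_fibre_shear[OF that(1) c(1) _ orth assms(3)] c show ?thesis by simp
  qed
  with assms show ?thesis by (meson order_antisym)
qed

text \<open>Changing one component at a time, \<open>(u, \<phi>)\<close> with \<open>\<phi> $ j \<noteq> 0\<close> is moved to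
  \<open>(e\<^sub>k, e\<^sub>k)\<close>, \<open>k \<noteq> j\<close>, through the functional \<open>\<phi> $ j \<cdot> e\<^sub>j + e\<^sub>k\<close>; this is why \<open>n \<ge> 2\<close> is needed.\<close>

lemma dual_pairs_connected:
  fixes F :: "'k::field vec \<times> 'k vec \<Rightarrow> 'b"
  assumes n: "n \<ge> 2" and x: "x \<in> dual_pairs n"
    and vector: "\<And>u u' \<phi>. (u, \<phi>) \<in> dual_pairs n \<Longrightarrow> (u', \<phi>) \<in> dual_pairs n \<Longrightarrow>
      F (u, \<phi>) = F (u', \<phi>)"
    and functional: "\<And>u \<phi> \<phi>'. (u, \<phi>) \<in> dual_pairs n \<Longrightarrow> (u, \<phi>') \<in> dual_pairs n \<Longrightarrow>
      F (u, \<phi>) = F (u, \<phi>')"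
  shows "F x = F (unit_vec n 0, unit_vec n 0)"
proof -
  let ?e = "unit_vec n :: nat \<Rightarrow> 'k vec"
  have away: "F (u, \<phi>) = F (?e k, ?e k)"
    if u\<phi>: "(u, \<phi>) \<in> dual_pairs n" and j: "j < n" "\<phi> $ j \<noteq> 0" and k: "k < n" "k \<noteq> j"
    for u \<phi> :: "'k vec" and j k
  proof -
    let ?u = "inverse (\<phi> $ j) \<cdot>\<^sub>v ?e j" and ?\<phi> = "(\<phi> $ j) \<cdot>\<^sub>v ?e j + ?e k"
    have "\<phi> \<in> carrier_vec n" using u\<phi> by (simp add: dual_pairs_def)
    then have "(?u, \<phi>) \<in> dual_pairs n" "(?u, ?\<phi>) \<in> dual_pairs n" "(?e k, ?\<phi>) \<in> dual_pairs n"
      "(?e k, ?e k) \<in> dual_pairs n"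
      using j k by (auto simp: dual_pairs_def add_scalar_prod_distrib[of _ n])
    then show ?thesis using u\<phi> vector functional by metis
  qed
  have unit: "(?e 1, ?e 1) \<in> dual_pairs n"
    using n by (simp add: dual_pairs_def)
  \<comment> \<open>\<open>away\<close> demands \<open>k \<noteq> j\<close>, so for
    \<open>j = 0\<close> the pair at index 0 is reached through the one at index 1.\<close>
  have base: "F (?e 1, ?e 1) = F (?e 0, ?e 0)"
    using n by (intro away[OF unit, of 1]) auto
  obtain u \<phi> where x_eq: "x = (u, \<phi>)" by fastforce
  have "\<phi> \<bullet> u = 1" "\<phi> \<in> carrier_vec n" "u \<in> carrier_vec n"
    using x by (auto simp: x_eq dual_pairs_def)
  then have "\<phi> \<noteq> 0\<^sub>v n" by auto
  then obtain j where j: "j < n" "\<phi> $ j \<noteq> 0"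
    using \<open>\<phi> \<in> carrier_vec n\<close> by (metis carrier_vecD eq_vecI index_zero_vec)
  show ?thesis
  proof (cases "j = 0")
    case True
    then have "F x = F (?e 1, ?e 1)"
      using x j n unfolding x_eq by (intro away[of u \<phi> 0]) auto
    with base show ?thesis by simp
  next
    case False
    then show ?thesis
      using x j n unfolding x_eq by (intro away[of u \<phi> j]) auto
  qed
qed

section \<open>Double counting of frames by colour\<close>

lemma card_fibre_const:
  fixes x :: "'k::{field,finite} vec \<times> 'k vec"
  assumes "n \<ge> 2" "i < n" "x \<in> dual_pairs n"
  shows "card (fibre n i x) = card (fibre n i (unit_vec n 0, unit_vec n 0 :: 'k vec))"
  using assms card_fibre_change_vector card_fibre_change_functional
  by (intro dual_pairs_connected[where F = "\<lambda>x. card (fibre n i x)"]) blast+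

text \<open>These frames are the disjoint union of the fibres over \<open>C\<close>, which all have
  the same size.\<close>

lemma card_frames_in:
  fixes C :: "('k::{field,finite} vec \<times> 'k vec) set"
  assumes n: "n \<ge> 2" and i: "i < n" and C: "C \<subseteq> dual_pairs n"
  shows "card {(g, h) \<in> frames n. (col g i, row h i) \<in> C} =
    card C * card (fibre n i (unit_vec n 0, unit_vec n 0 :: 'k vec))"
proof -
  have fin: "finite C"
    using C finite_dual_pairs finite_subset by blast
  have "{(g, h) \<in> frames n. (col g i, row h i) \<in> C} = (\<Union>x\<in>C. fibre n i x)"
    by (auto simp: fibre_def)
  also have "card \<dots> = (\<Sum>x\<in>C. card (fibre n i x))"
    using fin by (intro card_UN_disjoint)
      (auto simp: fibre_def intro: finite_subset[OF _ finite_frames[of n]])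
  also have "\<dots> = (\<Sum>x\<in>C. card (fibre n i (unit_vec n 0, unit_vec n 0 :: 'k vec)))"
    using C by (intro sum.cong refl card_fibre_const[OF n i]) blast
  finally show ?thesis by simp
qed

text \<open>Count the pairs of a frame and an index whose dual pair has colour 0. Each frame
  contributes one index, and index \<open>i\<close> contributes \<open>card ?C * N i\<close> frames;
  as \<open>card ?F = card ?P * N i\<close>, this gives
  \<open>card ?P = n * card ?C\<close>.\<close>

lemma dvd_card_dual_pairs:
  fixes c :: "'k::{field,finite} vec \<times> 'k vec \<Rightarrow> nat"
  assumes n: "n \<ge> 2"
    and range: "\<And>x. x \<in> dual_pairs n \<Longrightarrow> c x < n"
    and proper: "\<And>g h i j. (g, h) \<in> frames n \<Longrightarrow> i < n \<Longrightarrow> j < n \<Longrightarrow> i \<noteq> j \<Longrightarrow>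
      c (col g i, row h i) \<noteq> c (col g j, row h j)"
  shows "n dvd card (dual_pairs n :: ('k vec \<times> 'k vec) set)"
proof -
  let ?F = "frames n :: ('k mat \<times> 'k mat) set"
  let ?P = "dual_pairs n :: ('k vec \<times> 'k vec) set"
  let ?C = "{x \<in> ?P. c x = 0}"
  define N where "N i = card (fibre n i (unit_vec n 0, unit_vec n 0 :: 'k vec))" for i
  have N: "card ?F = card ?P * N i" if "i < n" for i
  proof -
    have "?F = {(g, h) \<in> ?F. (col g i, row h i) \<in> ?P}"
      using that frame_in_dual_pairs by blast
    then show ?thesis
      using card_frames_in[OF n that order_refl] by (metis (lifting) N_def)
  qed
  have one: "card {i. i < n \<and> (col (fst x) i, row (snd x) i) \<in> ?C} = 1" if "x \<in> ?F" for x
  proof -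
    obtain g h where x: "x = (g, h)" by fastforce
    let ?f = "\<lambda>i. c (col g i, row h i)"
    have inj: "inj_on ?f {..<n}"
      using that proper unfolding x inj_on_def by blast
    have sub: "?f ` {..<n} \<subseteq> {..<n}"
      using that range frame_in_dual_pairs unfolding x by blast
    \<comment> \<open>An injective self-map of a finite set is onto, so colour 0 occurs, at a unique
      index.\<close>
    have "?f ` {..<n} = {..<n}"
      using inj sub by (simp add: endo_inj_surj)
    moreover have "0 \<in> {..<n}" using n by simp
    ultimately have "0 \<in> ?f ` {..<n}" by simp
    then obtain k where k: "k < n" "?f k = 0" by auto
    have "{i. i < n \<and> (col (fst x) i, row (snd x) i) \<in> ?C} = {k}"
      using k inj that frame_in_dual_pairs[of g h n] by (auto simp: x inj_on_def)
    then show ?thesis by simp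
  qed
  have "card ?F = (\<Sum>x\<in>?F. card {i \<in> {..<n}. (col (fst x) i, row (snd x) i) \<in> ?C})"
    using one by simp
  also have "\<dots> = (\<Sum>i<n. card {x \<in> ?F. (col (fst x) i, row (snd x) i) \<in> ?C})"
    by (rule sum_multicount_gen) (auto simp: finite_frames)
  also have "\<dots> = (\<Sum>i<n. card ?C * N i)"
    using card_frames_in[OF n, of _ ?C]
    by (intro sum.cong refl) (auto simp: N_def case_prod_unfold)
  \<comment> \<open>Multiplying by \<open>card ?P\<close> replaces each \<open>N i\<close> by
    \<open>card ?F\<close>, which no longer depends on \<open>i\<close>.\<close>
  finally have "card ?P * card ?F = (\<Sum>i<n. card ?C * card ?F)"
    using N by (simp add: sum_distrib_left mult.left_commute)
  then have eq: "card ?P * card ?F = n * card ?C * card ?F"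
    by (simp only: sum_constant card_lessThan of_nat_id mult.assoc)
  \<comment> \<open>The identity frame makes \<open>card ?F\<close> nonzero, so that it
    cancels.\<close>
  have "(1\<^sub>m n, 1\<^sub>m n) \<in> ?F" by (simp add: frames_def)
  then have "card ?F \<noteq> 0" using finite_frames by (metis card_eq_0_iff empty_iff)
  with eq show ?thesis by simp
qed

section \<open>The number of dual pairs modulo p\<close>

text \<open>The level sets of \<open>\<phi> \<mapsto> \<phi> \<bullet> u\<close>, one for each
  scalar, partition the space and are translates of one another.\<close>

lemma card_affine_hyperplane:
  fixes u :: "'k::{field,finite} vec"
  assumes u: "u \<in> carrier_vec n" "u \<noteq> 0\<^sub>v n"
  shows "CARD('k) * card {\<phi> \<in> carrier_vec n. \<phi> \<bullet> u = 1} = CARD('k) ^ n"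
proof -
  let ?H = "\<lambda>c. {\<phi> \<in> carrier_vec n. \<phi> \<bullet> u = c}"
  obtain j where j: "j < n" "u $ j \<noteq> 0"
    using u by (metis carrier_vecD eq_vecI index_zero_vec)
  \<comment> \<open>Chosen so that \<open>?t c \<bullet> u = c\<close>: adding
    \<open>?t (1 - c)\<close> moves level \<open>c\<close> to level 1.\<close>
  let ?t = "\<lambda>c. (c / u $ j) \<cdot>\<^sub>v unit_vec n j"
  have eq: "card (?H c) = card (?H 1)" for c
  proof (rule bij_betw_same_card)
    show "bij_betw (\<lambda>\<phi>. \<phi> + ?t (1 - c)) (?H c) (?H 1)"
      using u j by (intro bij_betwI[of _ _ _ "\<lambda>\<phi>. \<phi> + ?t (c - 1)"])
        (auto simp: add_scalar_prod_distrib[of _ n] vec_eq_iff diff_divide_distrib algebra_simps)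
  qed
  have "CARD('k) ^ n = card (\<Union>c. ?H c)"
    by (subst card_carrier_vec[symmetric]) (rule arg_cong[of _ _ card], auto)
  also have "\<dots> = (\<Sum>c\<in>UNIV. card (?H c))"
    by (rule card_UN_disjoint) auto
  also have "\<dots> = CARD('k) * card (?H 1)"
    by (subst sum.cong[OF refl eq]) simp
  finally show ?thesis ..
qed

text \<open>Sum over the nonzero \<open>u\<close> the number of functionals with value 1 at
  \<open>u\<close>; the zero vector has none.\<close>

lemma card_dual_pairs:
  "CARD('k) * card (dual_pairs n :: ('k::{field,finite} vec \<times> 'k vec) set) =
    (CARD('k) ^ n - 1) * CARD('k) ^ n"
proof -
  let ?D = "carrier_vec n - {0\<^sub>v n} :: 'k vec set"
  have "dual_pairs n = (SIGMA u:?D. {\<phi> \<in> carrier_vec n. \<phi> \<bullet> u = 1})"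
    by (auto simp: dual_pairs_def)
  then have "CARD('k) * card (dual_pairs n :: ('k vec \<times> 'k vec) set) =
      (\<Sum>u\<in>?D. CARD('k) * card {\<phi> \<in> carrier_vec n. \<phi> \<bullet> u = 1})"
    by (simp add: sum_distrib_left)
  also have "\<dots> = (\<Sum>u\<in>?D. CARD('k) ^ n)"
    by (intro sum.cong refl card_affine_hyperplane) auto
  also have "\<dots> = (CARD('k) ^ n - 1) * CARD('k) ^ n"
    by (simp add: card_carrier_vec)
  finally show ?thesis .
qed

lemma not_dvd_card_dual_pairs:
  assumes p: "prime p" and q0: "\<not> [CARD('k) = 0] (mod p)" and q1: "\<not> [CARD('k) = 1] (mod p)"
  shows "\<not> p dvd card (dual_pairs p :: ('k::{field,finite} vec \<times> 'k vec) set)"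
proof
  let ?q = "CARD('k)"
  assume "p dvd card (dual_pairs p :: ('k vec \<times> 'k vec) set)"
  then have "p dvd (?q ^ p - 1) * ?q ^ p"
    unfolding card_dual_pairs[symmetric] by simp
  moreover have nq: "\<not> p dvd ?q"
    using q0 by (simp add: cong_0_iff)
  ultimately have "p dvd ?q ^ p - 1"
    using p by (metis prime_dvd_mult_iff prime_dvd_power)
  then have "[?q ^ p = 1] (mod p)"
    by (simp add: cong_altdef_nat Suc_le_eq)
  \<comment> \<open>Fermat's congruence for the exponent \<open>p - 1\<close>, multiplied by
    \<open>?q\<close>.\<close>
  moreover have "[?q ^ p = ?q] (mod p)"
    using cong_mult[OF fermat_theorem[OF p nq] cong_refl[of ?q p]] p
    by (simp flip: power_Suc2 add: prime_gt_0_nat)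
  ultimately show False
    using q1 by (meson cong_sym cong_trans)
qed

section \<open>Colourings of the span graph\<close>

definition vertex_of :: "nat \<Rightarrow> 'k::field vec \<times> 'k vec \<Rightarrow> 'k vec set \<times> 'k vec set" where
  "vertex_of n x = (line_of (fst x), perp n (snd x))"

lemma line_of_subset_perp:
  assumes "u \<in> carrier_vec n" "\<phi> \<in> carrier_vec n"
  shows "line_of u \<subseteq> perp n \<phi> \<longleftrightarrow> \<phi> \<bullet> u = 0"
proof
  assume "line_of u \<subseteq> perp n \<phi>"
  then have "1 \<cdot>\<^sub>v u \<in> perp n \<phi>" unfolding line_of_def by blast
  then show "\<phi> \<bullet> u = 0" by (simp add: perp_def)
qed (use assms in \<open>auto simp: line_of_def perp_def\<close>)

lemma vertex_of_in_span_graph: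
  assumes "x \<in> dual_pairs n"
  shows "vertex_of n x \<in> pverts (span_graph n)"
proof -
  have x: "fst x \<in> carrier_vec n" "snd x \<in> carrier_vec n" "snd x \<bullet> fst x = 1"
    using assms by (auto simp: dual_pairs_def)
  then have "fst x \<noteq> 0\<^sub>v n" by auto
  with x show ?thesis
    by (simp add: span_graph_def vertex_of_def line_of_in_lines perp_in_hyperplanes
        line_of_subset_perp)
qed

lemma vertex_of_adjacent:
  assumes "x \<in> dual_pairs n" "y \<in> dual_pairs n" "snd x \<bullet> fst y = 0" "snd y \<bullet> fst x = 0"
  shows "(vertex_of n x, vertex_of n y) \<in> parcs (span_graph n)"
proof -
  have "line_of (fst x) \<subseteq> perp n (snd y)" "line_of (fst y) \<subseteq> perp n (snd x)"
    using assms by (simp_all add: dual_pairs_def case_prod_unfold line_of_subset_perp)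
  then show ?thesis
    using vertex_of_in_span_graph[OF assms(1)] vertex_of_in_span_graph[OF assms(2)]
    by (simp add: span_graph_def Let_def vertex_of_def)
qed

text \<open>For distinct indices the duality relations of a basis and its dual basis are exactly the
  two inclusions that define adjacency.\<close>

lemma frame_clique:
  assumes "(g, h) \<in> frames n" "i < n" "j < n" "i \<noteq> j"
  shows "(vertex_of n (col g i, row h i), vertex_of n (col g j, row h j)) \<in> parcs (span_graph n)"
  using assms frame_in_dual_pairs by (intro vertex_of_adjacent) (auto simp: frames_scalar_prod)

text \<open>Pulled back along \<open>vertex_of\<close>, a colouring with at most \<open>p\<close>
  colours separates the pairs within every frame, so the double count would make \<open>p\<close>
  divide the number of dual pairs.\<close>

lemma not_proper_colouring_span_graph:
  fixes c :: "'k::{field,finite} vec set \<times> 'k vec set \<Rightarrow> nat"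
  assumes p: "prime p" and q: "\<not> [CARD('k) = 0] (mod p)" "\<not> [CARD('k) = 1] (mod p)"
    and "m \<le> p"
  shows "\<not> proper_colouring (span_graph p) m c"
proof
  assume c: "proper_colouring (span_graph p) m c"
  have "p dvd card (dual_pairs p :: ('k vec \<times> 'k vec) set)"
  proof (rule dvd_card_dual_pairs[where c = "c \<circ> vertex_of p"])
    fix x :: "'k vec \<times> 'k vec"
    assume "x \<in> dual_pairs p"
    then have "(c \<circ> vertex_of p) x \<in> {..<m}"
      using c vertex_of_in_span_graph[of x p] by (simp add: proper_colouring_def Pi_iff)
    with \<open>m \<le> p\<close> show "(c \<circ> vertex_of p) x < p" by simp
  next
    fix g h :: "'k mat" and i j
    assume "(g, h) \<in> frames p" "i < p" "j < p" "i \<noteq> j"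
    then show "(c \<circ> vertex_of p) (col g i, row h i) \<noteq> (c \<circ> vertex_of p) (col g j, row h j)"
      using c frame_clique[of g h p i j] by (auto simp: proper_colouring_def)
  qed (use p in \<open>simp add: prime_ge_2_nat\<close>)
  with not_dvd_card_dual_pairs[OF p q] show False by contradiction
qed

section \<open>The span chromatic number\<close>

lemma span_colouring_id: "span_colouring (span_graph n) n id"
  by (auto simp: span_colouring_def span_graph_def Let_def)

lemma hyperplane_subspace:
  "V \<in> hyperplanes n \<Longrightarrow> VectorSpace.subspace class_ring V (module_vec TYPE('k::field) n)"
  by (auto simp: hyperplanes_def subspaces_of_dim_def split: nat.splits)

lemma line_subset_carrier: "U \<in> lines n \<Longrightarrow> U \<subseteq> (carrier_vec n :: 'k::field vec set)"
  by (auto simp: lines_def subspaces_of_dim_def VectorSpace.subspace_def submodule_def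
      module_vec_simps)

text \<open>For a clique, pick \<open>v i\<close> in the \<open>i\<close>-th line outside the
  \<open>i\<close>-th hyperplane. That hyperplane contains all other \<open>v j\<close>, hence their
  span, so the \<open>m\<close> vectors are independent in dimension \<open>n\<close>.\<close>

lemma span_colouring_clique_le:
  fixes f :: "'a \<Rightarrow> 'k::field vec set \<times> 'k vec set" and x :: "nat \<Rightarrow> 'a"
  assumes f: "span_colouring G n f"
    and verts: "\<And>i. i < m \<Longrightarrow> x i \<in> pverts G"
    and arcs: "\<And>i j. i < m \<Longrightarrow> j < m \<Longrightarrow> i \<noteq> j \<Longrightarrow> (x i, x j) \<in> parcs G"
  shows "m \<le> n"
proof -
  interpret vec_space "TYPE('k)" n .
  have "\<exists>v. v \<in> fst (f (x i)) \<and> v \<notin> snd (f (x i))" if "i < m" for i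
    using f verts[OF that] by (auto simp: span_colouring_def)
  then obtain v where v: "\<And>i. i < m \<Longrightarrow> v i \<in> fst (f (x i)) \<and> v i \<notin> snd (f (x i))"
    by metis
  have off: "v j \<in> snd (f (x i))" if "i < m" "j < m" "i \<noteq> j" for i j
    using f arcs[OF that] v[OF that(2)] by (auto simp: span_colouring_def)
  \<comment> \<open>Equal vectors at distinct indices would lie both inside and outside one
    hyperplane.\<close>
  have inj: "inj_on v {..<m}"
    using v off by (metis inj_onI lessThan_iff)
  let ?S = "v ` {..<m}"
  have S: "?S \<subseteq> carrier_vec n"
  proof clarsimp
    fix i assume "i < m"
    with f verts have "fst (f (x i)) \<in> lines n" by (auto simp: span_colouring_def)
    with v[OF \<open>i < m\<close>] line_subset_carrier show "v i \<in> carrier_vec n" by blast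
  qed
  have "v i \<notin> span (?S - {v i})" if "i < m" for i
  proof -
    have "snd (f (x i)) \<in> hyperplanes n"
      using f verts[OF that] by (auto simp: span_colouring_def)
    then have "submodule class_ring (snd (f (x i))) V"
      using hyperplane_subspace by (auto simp: VectorSpace.subspace_def)
    moreover have "?S - {v i} \<subseteq> snd (f (x i))"
      using off[OF that] by auto
    ultimately have "span (?S - {v i}) \<subseteq> snd (f (x i))"
      by (intro span_is_subset)
    with v[OF that] show ?thesis by blast
  qed
  then have "lin_indpt ?S"
    using lindep_span[OF S] by auto
  from li_le_dim(2)[OF fin_dim S this] show ?thesis
    by (simp add: card_image[OF inj] dim_is_n)
qed

text \<open>The standard basis frame gives a clique of size \<open>m\<close>, to which the clique
  bound applies; the colouring may be over another field \<open>'l\<close>.\<close>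

lemma span_colouring_span_graph_ge:
  fixes f :: "'k::field vec set \<times> 'k vec set \<Rightarrow> 'l::field vec set \<times> 'l vec set"
  assumes "span_colouring (span_graph m) n f"
  shows "m \<le> n"
proof -
  have one: "(1\<^sub>m m, 1\<^sub>m m :: 'k mat) \<in> frames m" by (simp add: frames_def)
  show ?thesis
    by (rule span_colouring_clique_le[OF assms,
          where x = "\<lambda>i. vertex_of m (col (1\<^sub>m m) i, row (1\<^sub>m m) i)"])
      (auto intro: one frame_clique vertex_of_in_span_graph frame_in_dual_pairs simp del: row_one col_one)
qed

lemma span_chromatic_number_span_graph:
  "span_chromatic_number TYPE('k) (span_graph n :: ('k::field vec set \<times> 'k vec set) pair_pre_digraph)
    = enat n"
  unfolding span_chromatic_number_def
proof (rule antisym)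
  show "(INF m \<in> {m. \<exists>f :: 'k vec set \<times> 'k vec set \<Rightarrow> 'k vec set \<times> 'k vec set.
      span_colouring (span_graph n) m f}. enat m) \<le> enat n"
    using span_colouring_id by (intro INF_lower) blast
qed (auto intro!: INF_greatest dest: span_colouring_span_graph_ge)

theorem proposition5p4:
  fixes p q :: nat
    and A :: "('k::{field,finite} vec set \<times> 'k vec set) pair_pre_digraph"
  assumes "q = CARD('k)"
    and "prime p"
    and "\<not> [q = 0] (mod p)"
    and "\<not> [q = 1] (mod p)"
    and "A = span_graph p"
  shows "\<not> (\<exists>f. graph_hom A (complete_graph p) f) \<and>
    chromatic_number A > enat p \<and>
    enat p = span_chromatic_number TYPE('k) A"
proof (intro conjI)
  have none: "\<not> proper_colouring A m c" if "m \<le> p" for m c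
    using not_proper_colouring_span_graph that assms by blast
  have "proper_colouring A p f" if "graph_hom A (complete_graph p) f" for f
    using that by (fastforce simp: graph_hom_def complete_graph_def proper_colouring_def)
  with none show "\<not> (\<exists>f. graph_hom A (complete_graph p) f)" by blast
  \<comment> \<open>Every admissible number of colours exceeds \<open>p\<close>, so the infimum is
    at least \<open>p + 1\<close>, even over an empty set.\<close>
  have "enat (Suc p) \<le> chromatic_number A"
    unfolding chromatic_number_def
    using none by (intro INF_greatest) (auto simp: not_less_eq_eq[symmetric])
  then show "chromatic_number A > enat p"
    by (metis Suc_ile_eq)
  show "enat p = span_chromatic_number TYPE('k) A"
    by (simp add: assms(5) span_chromatic_number_span_graph)
qed

end
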